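(* Conditionally on $\boldsymbol m$, for every vertex-labelled multigraph $G$ on the vertex set $[n]$, $$\mathbb{P}_m\big(\mathrm{PA}^{(B)}_n(\boldsymbol m,\delta)= G\big)=\mathbb{P}_m\big(\mathrm{CPU}^{(\mathrm{NSL})}_n(\boldsymbol m,\boldsymbol\psi)= G\big),$$ where equality with $G$ means equality (isomorphism respecting labels) as vertex-labelled multigraphs, $\mathrm{PA}^{(B)}_n(\boldsymbol m,\delta)$ is preferential attachment model (B), and $\mathrm{CPU}^{(\mathrm{NSL})}_n(\boldsymbol m,\boldsymbol\psi)$ is the collapsed Pólya urn graph obtained from the Pólya urn graph without self-loops, with the sequence $\boldsymbol\psi$ of Beta random variables specified in the context.
   Context: $\mathbb{N}=\{1,2,\dots\}$ and $[n]=\{1,\dots,n\}$. $M$ is an $\mathbb{N}$-valued random variable with $\mathbb E[M^p]<\infty$ for some $p>1$, and $\delta>-\inf\operatorname{supp}(M)$ is fixed. $(m_i)_{i\ge3}$ are i.i.d. copies of $M$, $m_1=m_2=1$, $\boldsymbol m=(m_1,m_2,\dots)$, $m_{[l]}=\sum_{i\le l}m_i$, and $\mathbb P_m$ is the conditional law given $\boldsymbol m$. $G_0$ is a fixed initial graph on $\{1,2\}$ with degrees $a_1,a_2$, and $a_{[2]}=a_1+a_2$. A self-loop contributes $2$ to the degree. **Model (B).** Starting from $G_0$, vertices $v=3,4,\dots,n$ arrive successively, vertex $v$ with $m_v$ edges attached one at a time. If $d_u(v,j-1)$ is the degree of $u$ after the first $j-1$ edges of $v$ have been attached, then, given $\boldsymbol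 m$ and the current graph, the $j$-th edge of $v$ attaches to $u$ with probability $\frac{d_u(v,j-1)+\delta}{c_{v,j}}$ for $u<v$ and $\frac{d_v(v,j-1)+\frac{j-1}{m_v}\delta}{c_{v,j}}$ for $u=v$, where $c_{v,j}=a_{[2]}+2(m_{[v-1]}+j-3)+(v-1)\delta+\frac{j-1}{m_v}\delta$. **Beta variables.** Given $\boldsymbol m$, let $\psi_1\equiv1$, $\psi_2\sim\mathrm{Beta}(a_2+\delta,a_1+\delta)$ and, for $k\ge3$ and $l\in[m_k]$, $$\psi_{m_{[k-1]}+l}\sim\mathrm{Beta}\Big(1+\tfrac{\delta}{m_k},\ a_{[2]}+2(m_{[k-1]}+l-3)+(k-1)\delta+\tfrac{l-1}{m_k}\delta\Big),$$ all conditionally independent given $\boldsymbol m$; $\boldsymbol\psi=(\psi_i)_{i\ge1}$. **Collapsed Pólya urn graph (NSL).** Let $N=m_{[n]}$, $\mathcal S_0=0$, $\mathcal S_s=\prod_{i=s+1}^{N}(1-\psi_i)$ for $1\le s\le N$ (so $\mathcal S_N=1$), and $\mathcal I_s=[\mathcal S_{s-1},\mathcal S_s)$. Let $(U_s)$ be i.i.d. uniform on $[0,1]$, independent of $\boldsymbol\psi$. The graph $\mathrm{PU}^{(\mathrm{NSL})}_{N}(\boldsymbol 1,\boldsymbol\psi)$ on $[N]$ consists of $G_0$ on $\{1,2\}$ together with exactly one edge from each $s\in\{3,\dots,N\}$, which attaches to the $u\in[s-1]$ for which $U_s\mathcal S_{s-1}\in\mathcal I_u$. The graph $\mathrm{CPU}^{(\mathrm{NSL})}_n(\boldsymbol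 m,\boldsymbol\psi)$ on $[n]$ is obtained by collapsing, for each $k\in[n]$, the group $\{m_{[k-1]}+1,\dots,m_{[k]}\}$ into a single vertex $k$. Edges within a group become self-loops and edges between different groups become edges between the corresponding vertices (with multiplicity).
   Formalization: The second Beta parameter of ψ for k≥3 is taken as the printed one plus 1; as printed the identity fails (M=1, δ=0, G_0 one edge {1,2}, n=4: vertex 4 attaches to 3 with probability 1/4 versus 1/3). Also a_1+δ, a_2+δ>0 and n≥2 are made explicit. *)

theory Defs
  imports "HOL-Probability.Probability" "HOL-Library.Uprod"
begin

(* A vertex-labelled multigraph is given by its multiset of edges, an edge being an unordered
   pair and a self-loop the pair "Upair u u"; the vertex set is carried separately. Two
   multigraphs on the same labelled vertex set are equal as labelled multigraphs iff their edge
   multisets coincide. *)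
type_synonym mgraph = "nat uprod multiset"

definition mgraph_on :: "nat set \<Rightarrow> mgraph \<Rightarrow> bool" where
  "mgraph_on V G \<longleftrightarrow> (\<forall>e \<in># G. set_uprod e \<subseteq> V)"

definition mdegree :: "mgraph \<Rightarrow> nat \<Rightarrow> nat" where
  "mdegree G u = size {#e \<in># G. u \<in> set_uprod e#} + count G (Upair u u)"

definition init_degree :: "mgraph \<Rightarrow> real" where
  "init_degree G0 = real (mdegree G0 1) + real (mdegree G0 2)"

definition psum :: "(nat \<Rightarrow> nat) \<Rightarrow> nat \<Rightarrow> nat" where
  "psum m l = (\<Sum>i = 1..l. m i)"


text \<open>Model (B), as the law given the sequence \<open>m\<close>.\<close>

definition attach_norm :: "real \<Rightarrow> mgraph \<Rightarrow> (nat \<Rightarrow> nat) \<Rightarrow> nat \<Rightarrow> nat \<Rightarrow> real" where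
  "attach_norm \<delta> G0 m v j =
     init_degree G0 + 2 * (real (psum m (v - 1)) + real j - 3) + (real v - 1) * \<delta>
       + (real j - 1) / real (m v) * \<delta>"

(* The end point in {1..v} of the j-th edge of v, where H is the graph with the first j - 1
   edges of v already attached. *)
definition attach_pmf ::
    "real \<Rightarrow> mgraph \<Rightarrow> (nat \<Rightarrow> nat) \<Rightarrow> nat \<Rightarrow> nat \<Rightarrow> mgraph \<Rightarrow> nat pmf" where
  "attach_pmf \<delta> G0 m v j H = embed_pmf (\<lambda>u.
     if 1 \<le> u \<and> u < v then (real (mdegree H u) + \<delta>) / attach_norm \<delta> G0 m v j
     else if u = v then
       (real (mdegree H v) + (real j - 1) / real (m v) * \<delta>) / attach_norm \<delta> G0 m v j
     else 0)"

primrec attach_edges ::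
    "real \<Rightarrow> mgraph \<Rightarrow> (nat \<Rightarrow> nat) \<Rightarrow> nat \<Rightarrow> mgraph \<Rightarrow> nat \<Rightarrow> mgraph pmf" where
  "attach_edges \<delta> G0 m v H 0 = return_pmf H"
| "attach_edges \<delta> G0 m v H (Suc j) =
     bind_pmf (attach_edges \<delta> G0 m v H j) (\<lambda>H'.
       map_pmf (\<lambda>u. add_mset (Upair u v) H') (attach_pmf \<delta> G0 m v (Suc j) H'))"

primrec PA_B :: "real \<Rightarrow> mgraph \<Rightarrow> (nat \<Rightarrow> nat) \<Rightarrow> nat \<Rightarrow> mgraph pmf" where
  "PA_B \<delta> G0 m 0 = return_pmf G0"
| "PA_B \<delta> G0 m (Suc k) =
     (if Suc k \<le> 2 then return_pmf G0
      else bind_pmf (PA_B \<delta> G0 m k) (\<lambda>H. attach_edges \<delta> G0 m (Suc k) H (m (Suc k))))"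


definition beta_measure :: "real \<Rightarrow> real \<Rightarrow> real measure" where
  "beta_measure a b = density lborel (\<lambda>x.
     ennreal (if 0 < x \<and> x < 1 then x powr (a - 1) * (1 - x) powr (b - 1) / Beta a b else 0))"

definition group_of :: "(nat \<Rightarrow> nat) \<Rightarrow> nat \<Rightarrow> nat" where
  "group_of m s = (THE k. s \<in> {psum m (k - 1) + 1..psum m k})"

(* For s >= 3 write s = psum m (k - 1) + l with 1 <= l <= m k. The second Beta parameter is the
   total weight (degrees plus shifts) of the vertices 1, ..., s - 1 just after s has attached its
   edge to one of them: they then have total degree init_degree G0 + 2 (s - 3) + 1.
   The "+ 1", absent from the printed formula a_[2] + 2 (m_[k-1] + l - 3) + (k - 1) \<delta> + ..., is the
   half-edge that s contributes to its neighbour. (The printed formula fits the urn graph with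
   self-loops, where s may attach to itself.) Without it the identity fails: if m i = 1 for
   all i, G0 is a single edge between 1 and 2, and \<delta> = 0, then vertex 4 attaches to vertex 3 with
   probability 1/4 in model (B), and with probability E \<psi>_3 in the urn graph, which is 1/4 for
   \<psi>_3 ~ Beta(1, 3) but 1/3 for Beta(1, 2). *)
definition psi_marginal ::
    "real \<Rightarrow> mgraph \<Rightarrow> (nat \<Rightarrow> nat) \<Rightarrow> nat \<Rightarrow> real measure" where
  "psi_marginal \<delta> G0 m s =
     (if s = 1 then return borel 1
      else if s = 2 then beta_measure (real (mdegree G0 2) + \<delta>) (real (mdegree G0 1) + \<delta>)
      else (let k = group_of m s; l = s - psum m (k - 1) in
        beta_measure (1 + \<delta> / real (m k))
          (init_degree G0 + 2 * (real (psum m (k - 1)) + real l - 3) + 1 + (real k - 1) * \<delta>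
             + (real l - 1) / real (m k) * \<delta>)))"

(* Joint law, given m, of the pair of sequences (\<psi>, U). *)
definition urn_space ::
    "real \<Rightarrow> mgraph \<Rightarrow> (nat \<Rightarrow> nat) \<Rightarrow> ((nat \<Rightarrow> real) \<times> (nat \<Rightarrow> real)) measure" where
  "urn_space \<delta> G0 m =
     (\<Pi>\<^sub>M s \<in> {1..}. psi_marginal \<delta> G0 m s) \<Otimes>\<^sub>M (\<Pi>\<^sub>M s \<in> {1..}. uniform_measure lborel {0..1})"

definition urn_pos :: "nat \<Rightarrow> (nat \<Rightarrow> real) \<Rightarrow> nat \<Rightarrow> real" where
  "urn_pos N \<psi> s = (if s = 0 then 0 else (\<Prod>i = s + 1..N. 1 - \<psi> i))"

definition urn_interval :: "nat \<Rightarrow> (nat \<Rightarrow> real) \<Rightarrow> nat \<Rightarrow> real set" where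
  "urn_interval N \<psi> s = {urn_pos N \<psi> (s - 1)..<urn_pos N \<psi> s}"

(* The neighbour is uniquely determined outside a null set of (\<psi>, U). *)
definition urn_target :: "nat \<Rightarrow> (nat \<Rightarrow> real) \<Rightarrow> (nat \<Rightarrow> real) \<Rightarrow> nat \<Rightarrow> nat" where
  "urn_target N \<psi> U s =
     (THE u. u \<in> {1..s - 1} \<and> U s * urn_pos N \<psi> (s - 1) \<in> urn_interval N \<psi> u)"

definition PU_NSL :: "mgraph \<Rightarrow> nat \<Rightarrow> (nat \<Rightarrow> real) \<Rightarrow> (nat \<Rightarrow> real) \<Rightarrow> mgraph" where
  "PU_NSL G0 N \<psi> U = G0 + {#Upair (urn_target N \<psi> U s) s. s \<in># mset_set {3..N}#}"

definition CPU_NSL ::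
    "mgraph \<Rightarrow> (nat \<Rightarrow> nat) \<Rightarrow> nat \<Rightarrow> (nat \<Rightarrow> real) \<Rightarrow> (nat \<Rightarrow> real) \<Rightarrow> mgraph" where
  "CPU_NSL G0 m n \<psi> U = image_mset (map_uprod (group_of m)) (PU_NSL G0 (psum m n) \<psi> U)"

end

theory Submission
  imports Defs
begin

text \<open>
  Record an urn graph by its history \<open>t\<close>, where \<open>t s\<close> is the neighbour of \<open>s\<close>. Given \<open>\<psi>\<close>, the
  history \<open>t\<close> has probability \<open>\<Prod>s. \<psi>\<^bsub>t s\<^esub> \<Prod>t s < i < s. (1 - \<psi>\<^sub>i)\<close>. Averaging over the independent
  Beta variables gives \<open>\<Prod>i. B(w\<^sub>i, S\<^bsub>i-1\<^esub>) / B(\<alpha>\<^sub>i, \<beta>\<^sub>i)\<close>, where \<open>w\<^sub>i\<close> is the final weight of \<open>i\<close> and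
  \<open>S\<^sub>i = w\<^sub>1 + \<dots> + w\<^sub>i\<close>. Raising one weight \<open>w\<^sub>u\<close> by 1 multiplies this product by \<open>w\<^sub>u / S\<^sub>N\<close>, so it
  is also the probability of \<open>t\<close> in the process in which each new vertex attaches to \<open>u\<close> with
  probability proportional to \<open>w\<^sub>u\<close>. The weights of the members of a group add up to the weight
  that model (B) gives to the collapsed vertex, so this process collapses to model (B).
\<close>

section \<open>Beta integrals\<close>

lemma Beta_real_pos: "a > 0 \<Longrightarrow> b > 0 \<Longrightarrow> Beta a b > 0" for a b :: real
  by (auto simp: Beta_def intro!: divide_pos_pos mult_pos_pos add_pos_pos)

text \<open>Multiplying the Beta density by \<open>x ^ p * (1 - x) ^ q\<close> only shifts its
  exponents by \<open>p\<close> and \<open>q\<close>, so the integral is again a Beta function. The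
  open interval is the range that \<open>proper\<close> later imposes on the urn variables.\<close>

lemma nn_integral_beta_measure:
  fixes a b :: real
  assumes "a > 0" "b > 0"
  shows "(\<integral>\<^sup>+x. ennreal (x ^ p * (1 - x) ^ q) * indicator {0<..<1} x \<partial>beta_measure a b)
         = ennreal (Beta (a + real p) (b + real q) / Beta a b)"
proof -
  let ?f = "\<lambda>x::real. x powr (a + real p - 1) * (1 - x) powr (b + real q - 1)"
  have B: "Beta a b > 0" using assms by (rule Beta_real_pos)
  have "(?f has_integral Beta (a + real p) (b + real q)) {0..1}"
    using has_integral_Beta_real[of "a + real p" "b + real q"] assms by simp
  then have I: "(\<integral>\<^sup>+x. ennreal (?f x) * indicator {0..1} x \<partial>lborel) = ennreal (Beta (a + real p) (b + real q))"
    
    using nn_integral_has_integral_lebesgue[of "{0..1}" ?f] by (simp add: nn_integral_completion mult.commute ennreal_mult'' ennreal_indicator)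
  have "(\<integral>\<^sup>+x. ennreal (x ^ p * (1 - x) ^ q) * indicator {0<..<1} x \<partial>beta_measure a b)
      = (\<integral>\<^sup>+x. ennreal (1 / Beta a b) * (ennreal (?f x) * indicator {0..1} x) \<partial>lborel)"
    unfolding beta_measure_def
  proof (subst nn_integral_density, measurable, intro nn_integral_cong_AE)
    have "AE x in lborel. x \<noteq> (0::real)" "AE x in lborel. x \<noteq> (1::real)"
      by (rule AE_lborel_singleton)+
    then show "AE x in lborel. ennreal (if 0 < x \<and> x < 1 then x powr (a - 1) * (1 - x) powr (b - 1) / Beta a b else 0)
         * (ennreal (x ^ p * (1 - x) ^ q) * indicator {0<..<1} x)
       = ennreal (1 / Beta a b) * (ennreal (?f x) * indicator {0..1} x)"
    proof eventually_elim
      case (elim x)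
      have "?f x = x powr (a - 1) * (1 - x) powr (b - 1) * (x ^ p * (1 - x) ^ q)" if "0 < x" "x < 1"
        using that powr_add[of x "a - 1" "real p"] powr_add[of "1 - x" "b - 1" "real q"]
        by (simp add: powr_realpow algebra_simps)
      with elim B show ?case
        by (auto simp: indicator_def ennreal_mult'[symmetric] divide_inverse mult_ac)
    qed
  qed
  also have "\<dots> = ennreal (1 / Beta a b) * ennreal (Beta (a + real p) (b + real q))"
    by (subst nn_integral_cmult) (auto simp: I)
  also have "\<dots> = ennreal (Beta (a + real p) (b + real q) / Beta a b)"
    using B by (subst ennreal_mult'[symmetric]) (auto simp: field_simps)
  finally show ?thesis .
qed

lemma prob_space_beta_measure:
  fixes a b :: real
  assumes "a > 0" "b > 0"
  shows "prob_space (beta_measure a b)"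
proof
  have B: "Beta a b > 0" using assms by (rule Beta_real_pos)
  have "emeasure (beta_measure a b) (space (beta_measure a b)) =
      (\<integral>\<^sup>+x. ennreal (if 0 < x \<and> x < 1 then x powr (a - 1) * (1 - x) powr (b - 1) / Beta a b else 0)  \<partial>lborel)"
    unfolding beta_measure_def by (subst emeasure_density) auto
  also have "\<dots> = (\<integral>\<^sup>+x. ennreal (x ^ 0 * (1 - x) ^ 0) * indicator {0<..<1} x \<partial>beta_measure a b)"
    unfolding beta_measure_def
    by (subst nn_integral_density, measurable) (auto intro!: nn_integral_cong simp: indicator_def)
  also have "\<dots> = 1"
    using nn_integral_beta_measure[OF assms, of 0 0] B by simp
  finally show "emeasure (beta_measure a b) (space (beta_measure a b)) = 1" .
qed

lemma sets_beta_measure [measurable_cong, simp]: "sets (beta_measure a b) = sets borel"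
  by (simp add: beta_measure_def)

lemma Beta_Suc_left: "a > 0 \<Longrightarrow> b > 0 \<Longrightarrow> Beta (a + 1) b = Beta a b * a / (a + b)" for a b :: real
  using Beta_plus1_left[of a b] by (force simp: field_simps elim!: nonpos_Ints_cases)

lemma Beta_Suc_right: "a > 0 \<Longrightarrow> b > 0 \<Longrightarrow> Beta a (b + 1) = Beta a b * b / (a + b)" for a b :: real
  using Beta_Suc_left[of b a] by (simp add: Beta_commute add.commute)

text \<open>Let \<open>S i\<close> be the sum of the weights up to \<open>i\<close>. Raising
  \<open>w u\<close> leaves the factors below \<open>u\<close> alone, multiplies factor
  \<open>u\<close> by \<open>w u / S u\<close> and each later factor \<open>i\<close> by
  \<open>S (i - 1) / S i\<close>, which telescopes to \<open>w u / S N\<close>. For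
  \<open>u = 1\<close> the later factors alone give \<open>S 1 / S N\<close>.\<close>

lemma prod_Beta_upd:
  fixes w :: "nat \<Rightarrow> real"
  assumes "\<And>i. i \<ge> 1 \<Longrightarrow> w i > 0" "1 \<le> N" "u \<in> {1..N}"
  defines "w' \<equiv> w(u := w u + 1)"
  shows "(\<Prod>i = 2..N. Beta (w' i) (\<Sum>j = 1..<i. w' j))
       = (\<Prod>i = 2..N. Beta (w i) (\<Sum>j = 1..<i. w j)) * (w u / (\<Sum>j = 1..N. w j))"
  using assms(2,3)
proof (induction N rule: nat_induct_at_least)
  case base
  then show ?case using assms(1)[of 1] by simp
next
  case (Suc N)
  let ?S = "\<Sum>j = 1..N. w j"
  have S: "?S > 0" using Suc.hyps assms(1) by (intro sum_pos) auto
  have w: "w (Suc N) > 0" "w u > 0" using assms(1) Suc.prems by auto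
  have ivl: "{1..<Suc N} = {1..N}" by auto
  have split: "(\<Prod>i = 2..Suc N. f i) = (\<Prod>i = 2..N. f i) * f (Suc N)" for f :: "nat \<Rightarrow> real"
    using Suc.hyps by (simp add: prod.nat_ivl_Suc')
  show ?case
  proof (cases "u = Suc N")
    case True
    have w'j: "w' j = w j" if "j \<le> N" for j using True that by (simp add: w'_def)
    have "(\<Prod>i = 2..N. Beta (w' i) (\<Sum>j = 1..<i. w' j)) = (\<Prod>i = 2..N. Beta (w i) (\<Sum>j = 1..<i. w j))"
      by (intro prod.cong arg_cong2[of _ _ _ _ Beta] sum.cong) (auto simp: w'j)
    moreover have "(\<Sum>j = 1..N. w' j) = ?S" by (intro sum.cong) (auto simp: w'j)
    moreover have "w' (Suc N) = w (Suc N) + 1" using True by (simp add: w'_def)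
    ultimately show ?thesis
      using True Beta_Suc_left[OF w(1) S] unfolding split ivl by (simp add: add.commute del: prod.cl_ivl_Suc)
  next
    case False
    with Suc.prems have u: "u \<in> {1..N}" by auto
    have "(\<Sum>j = 1..N. w' j) = ?S + 1"
      using u unfolding w'_def by (subst (1 2) sum.remove[of "{1..N}" u]) auto
    moreover have "w' (Suc N) = w (Suc N)" using False by (simp add: w'_def)
    ultimately show ?thesis
      using Suc.IH[OF u] S Beta_Suc_right[OF w(1) S] unfolding split ivl by (simp add: add.commute del: prod.cl_ivl_Suc)
  qed
qed

section \<open>Reinforced attachment histories\<close>

lemma sum_card_fibres:
  assumes "finite A" "finite B" 
  shows "(\<Sum>u\<in>A. real (card {s\<in>B. f s = u})) = real (card {s\<in>B. f s \<in> A})"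
proof -
  have "card {s\<in>B. f s \<in> A} = card (\<Union>u\<in>A. {s\<in>B. f s = u})"
    by (rule arg_cong[of _ _ card]) auto
  also have "\<dots> = (\<Sum>u\<in>A. card {s\<in>B. f s = u})"
    using assms by (intro card_UN_disjoint) auto
  finally show ?thesis by simp
qed

text \<open>The urn is treated for arbitrary positive initial weights; groups and
  \<open>\<delta>\<close> enter only later, through a particular choice of
  \<open>\<alpha>\<close>.\<close>

locale urn_weights =
  fixes \<alpha> :: "nat \<Rightarrow> real"
  assumes \<alpha>_pos: "i \<ge> 1 \<Longrightarrow> \<alpha> i > 0"
begin

text \<open>Only edges received are counted. The half-edge that a vertex sends out belongs to its
  initial weight, which is why the later choice of \<open>\<alpha>\<close> contains a 1 from vertex
  3 on.\<close>

definition wt :: "(nat \<Rightarrow> nat) \<Rightarrow> nat \<Rightarrow> nat \<Rightarrow> real" where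
  "wt t N u = \<alpha> u + real (card {s\<in>{3..N}. t s = u})"

text \<open>Equal to \<open>\<Sum>u = 1..N. wt t N u\<close> for every history \<open>t\<close>: each of \<open>3, \<dots>, N\<close> adds 1 to one weight.\<close>

definition total :: "nat \<Rightarrow> real" where
  "total N = (\<Sum>u = 1..N. \<alpha> u) + real N - 2"

text \<open>Extensional functions make this set finite and let a history be compared with a
  restriction of \<open>urn_target\<close>. On at most two vertices the only history is
  \<open>undefined\<close> everywhere, the starting value of \<open>hist_pmf\<close>.\<close>

definition histories :: "nat \<Rightarrow> (nat \<Rightarrow> nat) set" where
  "histories N = (\<Pi>\<^sub>E s\<in>{3..N}. {1..s - 1})"

text \<open>For an arbitrary \<open>t\<close> the values need not sum to 1;
  \<open>pmf_step_pmf\<close> justifies the use of \<open>embed_pmf\<close> for histories on at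
  least two vertices.\<close>

definition step_pmf :: "(nat \<Rightarrow> nat) \<Rightarrow> nat \<Rightarrow> nat pmf" where
  "step_pmf t N = embed_pmf (\<lambda>u. if u \<in> {1..N} then wt t N u / total N else 0)"

primrec hist_pmf :: "nat \<Rightarrow> (nat \<Rightarrow> nat) pmf" where
  "hist_pmf 0 = return_pmf (\<lambda>_. undefined)"
| "hist_pmf (Suc N) =
     (if Suc N \<le> 2 then return_pmf (\<lambda>_. undefined)
      else bind_pmf (hist_pmf N) (\<lambda>t. map_pmf (\<lambda>u. t(Suc N := u)) (step_pmf t N)))"

lemma hist_pmf_2: "hist_pmf 2 = return_pmf (\<lambda>_. undefined)"
  by (simp add: numeral_2_eq_2)

lemma hist_pmf_Suc:
  "N \<ge> 2 \<Longrightarrow> hist_pmf (Suc N) = bind_pmf (hist_pmf N) (\<lambda>t. map_pmf (\<lambda>u. t(Suc N := u)) (step_pmf t N))"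
  by simp

lemma wt_pos: "u \<ge> 1 \<Longrightarrow> wt t N u > 0"
  using \<alpha>_pos[of u] by (simp add: wt_def add_pos_nonneg)

lemma finite_histories: "finite (histories N)"
  unfolding histories_def by (intro finite_PiE) auto

text \<open>Targets satisfy \<open>t s < s\<close>, so every \<open>s \<le> i\<close> attaches below
  \<open>i\<close>; this accounts for the fixed term \<open>i - 2\<close>. A later \<open>s\<close>
  contributes exactly if its target lies below \<open>i\<close>, and the number of such
  \<open>s\<close> is also the exponent of \<open>1 - \<psi> i\<close> in the probability of
  \<open>t\<close>.\<close>

lemma sum_wt:
  assumes "t \<in> histories N" "1 \<le> i" "i \<le> N"
  shows "(\<Sum>u = 1..<i. wt t N u) =
           (\<Sum>u = 1..<i. \<alpha> u) + real (i - 2) + real (card {s\<in>{3..N}. t s < i \<and> i < s})"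
proof -
  have t: "t s \<in> {1..s - 1}" if "s \<in> {3..N}" for s
    using assms(1) that by (auto simp: histories_def)
  have "{s\<in>{3..N}. t s \<in> {1..<i}} = {3..i} \<union> {s\<in>{3..N}. t s < i \<and> i < s}"
  proof (intro set_eqI iffI)
    fix s assume "s \<in> {3..i} \<union> {s\<in>{3..N}. t s < i \<and> i < s}"
    then show "s \<in> {s\<in>{3..N}. t s \<in> {1..<i}}" using t[of s] assms by auto
  qed auto
  then have "card {s\<in>{3..N}. t s \<in> {1..<i}} = (i - 2) + card {s\<in>{3..N}. t s < i \<and> i < s}"
    by (subst \<open>_ = _\<close>, subst card_Un_disjoint) auto
  then show ?thesis
    unfolding wt_def sum.distrib by (subst sum_card_fibres) auto
qed

lemma sum_wt_total:
  assumes "t \<in> histories N" "N \<ge> 2"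
  shows "(\<Sum>u = 1..N. wt t N u) = total N"
proof -
  have t: "t s \<in> {1..s - 1}" if "s \<in> {3..N}" for s
    using assms(1) that by (auto simp: histories_def)
  have "{s\<in>{3..N}. t s \<in> {1..N}} = {3..N}" using t by force
  then have "(\<Sum>u = 1..N. real (card {s\<in>{3..N}. t s = u})) = real N - 2"
    using assms(2) by (subst sum_card_fibres) (auto simp: of_nat_diff)
  then show ?thesis by (simp add: wt_def total_def sum.distrib)
qed

lemma total_pos: "N \<ge> 2 \<Longrightarrow> total N > 0"
  unfolding total_def using sum_pos[of "{1..N}" \<alpha>] \<alpha>_pos by auto

lemma pmf_step_pmf:
  assumes "t \<in> histories N" "N \<ge> 2"
  shows "pmf (step_pmf t N) u = (if u \<in> {1..N} then wt t N u / total N else 0)"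
  unfolding step_pmf_def
proof (subst pmf_embed_pmf)
  show "0 \<le> (if u \<in> {1..N} then wt t N u / total N else 0)" for u
    using wt_pos[of u t N] total_pos[of N] assms by (auto intro!: divide_nonneg_nonneg less_imp_le)
  have "(\<integral>\<^sup>+ u. ennreal (if u \<in> {1..N} then wt t N u / total N else 0) \<partial>count_space UNIV)
     = (\<Sum>u\<in>{1..N}. ennreal (wt t N u / total N))"
    by (subst nn_integral_count_space'[of "{1..N}"]) auto
  also have "\<dots> = ennreal (\<Sum>u\<in>{1..N}. wt t N u / total N)"
    using wt_pos[of _ t N] total_pos[of N] assms
    by (intro sum_ennreal) (auto intro!: divide_nonneg_nonneg less_imp_le)
  also have "(\<Sum>u\<in>{1..N}. wt t N u / total N) = 1"
    using sum_wt_total[OF assms] total_pos[of N] assms by (simp flip: sum_divide_distrib)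
  finally show "(\<integral>\<^sup>+ u. ennreal (if u \<in> {1..N} then wt t N u / total N else 0) \<partial>count_space UNIV) = 1" by simp
qed simp

lemma histories_Suc:
  "N \<ge> 2 \<Longrightarrow> histories (Suc N) = (\<lambda>(t, u). t(Suc N := u)) ` (histories N \<times> {1..N})"
proof -
  assume "N \<ge> 2"
  then have *: "{3..Suc N} = insert (Suc N) {3..N}" by auto
  show ?thesis unfolding histories_def * PiE_insert_eq
    by (auto simp: image_def)
qed

lemma set_hist_pmf: "N \<ge> 2 \<Longrightarrow> set_pmf (hist_pmf N) \<subseteq> histories N"
proof (induction N rule: nat_induct_at_least)
  case base
  show ?case by (simp add: hist_pmf_2 histories_def)
next
  case (Suc N)
  have "u \<in> {1..N}" if "t \<in> histories N" "u \<in> set_pmf (step_pmf t N)" for t u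
    using that Suc.hyps by (auto simp: set_pmf_iff pmf_step_pmf split: if_splits)
  then show ?case
    using Suc by (fastforce simp: hist_pmf_Suc histories_Suc simp del: hist_pmf.simps)
qed

text \<open>The old history is recovered from the new one by resetting coordinate
  \<open>Suc N\<close> to \<open>undefined\<close>, so only one term of the mixture over old
  histories survives.\<close>

lemma pmf_hist_Suc:
  assumes "N \<ge> 2" "t \<in> histories N" "u \<in> {1..N}"
  shows "pmf (hist_pmf (Suc N)) (t(Suc N := u)) = pmf (hist_pmf N) t * (wt t N u / total N)"
proof -
  have undef: "t' (Suc N) = undefined" if "t' \<in> histories N" for t'
    using that by (auto simp: histories_def PiE_def extensional_def)
  have "pmf (hist_pmf (Suc N)) (t(Suc N := u)) =
      (\<Sum>t'\<in>histories N. pmf (hist_pmf N) t' * pmf (map_pmf (\<lambda>u. t'(Suc N := u)) (step_pmf t' N)) (t(Suc N := u)))"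
    unfolding hist_pmf_Suc[OF assms(1)] pmf_bind
    using set_hist_pmf[OF assms(1)] finite_histories
    by (subst integral_measure_pmf_real[of "histories N"]) (auto simp: mult_ac)
  also have "\<dots> = (\<Sum>t'\<in>histories N. if t' = t then pmf (hist_pmf N) t * (wt t N u / total N) else 0)"
  proof (intro sum.cong refl)
    fix t' assume t': "t' \<in> histories N"
    show "pmf (hist_pmf N) t' * pmf (map_pmf (\<lambda>u. t'(Suc N := u)) (step_pmf t' N)) (t(Suc N := u))
        = (if t' = t then pmf (hist_pmf N) t * (wt t N u / total N) else 0)"
    proof (cases "t' = t")
      case True
      have "pmf (map_pmf (\<lambda>u. t(Suc N := u)) (step_pmf t N)) (t(Suc N := u)) = pmf (step_pmf t N) u"
        by (rule pmf_map_inj') (auto intro!: injI dest: fun_upd_eqD)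
      then show ?thesis using True assms by (simp add: pmf_step_pmf)
    next
      case False
      have "t' = t'(Suc N := undefined)" "t = t(Suc N := undefined)"
        using undef t' assms by auto
      then have "t'(Suc N := x) \<noteq> t(Suc N := u)" for x
        using False by (metis fun_upd_upd)
      then have "t(Suc N := u) \<noteq> t'(Suc N := x)" for x by metis
      then have "pmf (map_pmf (\<lambda>u. t'(Suc N := u)) (step_pmf t' N)) (t(Suc N := u)) = 0"
        by (auto simp: pmf_eq_0_set_pmf)
      then show ?thesis using False by simp
    qed
  qed
  also have "\<dots> = pmf (hist_pmf N) t * (wt t N u / total N)"
    using assms finite_histories by simp
  finally show ?thesis .
qed


section \<open>The probability of a history as a product of Beta ratios\<close>

definition \<beta> :: "nat \<Rightarrow> real" where
  "\<beta> i = (\<Sum>u = 1..<i. \<alpha> u) + real (i - 2)"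

lemma \<beta>_pos: "i \<ge> 2 \<Longrightarrow> \<beta> i > 0"
  unfolding \<beta>_def using sum_pos[of "{1..<i}" \<alpha>] \<alpha>_pos by (intro add_pos_nonneg) auto

text \<open>The edge of vertex \<open>Suc N\<close> adds 1 to the total weight of
  \<open>1, ..., N\<close>. Thus \<open>\<beta> i\<close> is the weight of the vertices below
  \<open>i\<close> just after \<open>i\<close> has attached.\<close>

lemma \<beta>_Suc: "N \<ge> 2 \<Longrightarrow> \<beta> (Suc N) = total N + 1"
  by (simp add: \<beta>_def total_def atLeastLessThanSuc_atLeastAtMost of_nat_diff Suc_diff_le)

text \<open>Induction on \<open>N\<close>. The new vertex has received no edge and the vertices
  below it have total weight \<open>\<beta> (Suc N)\<close>, so its factor is 1. By
  \<open>prod_Beta_upd\<close> the other factors change by \<open>wt t' N u / total N\<close>, the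
  probability of the new step.\<close>

lemma pmf_hist_pmf:
  assumes "N \<ge> 2" "t \<in> histories N"
  shows "pmf (hist_pmf N) t = (\<Prod>i = 2..N. Beta (wt t N i) (\<Sum>u = 1..<i. wt t N u) / Beta (\<alpha> i) (\<beta> i))"
  using assms
proof (induction N arbitrary: t rule: nat_induct_at_least)
  case base
  then have "t = (\<lambda>_. undefined)" by (simp add: histories_def)
  moreover have "Beta (\<alpha> 2) (\<alpha> 1) > 0"
    using \<alpha>_pos[of 1] \<alpha>_pos[of 2] by (auto intro: Beta_real_pos)
  moreover have "{1..<2} = {1::nat}" by auto
  ultimately show ?case by (simp add: hist_pmf_2 wt_def \<beta>_def)
next
  case (Suc N)
  from Suc.prems obtain t' u where t: "t = t'(Suc N := u)" "t' \<in> histories N" "u \<in> {1..N}"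
    using histories_Suc[OF Suc.hyps] by auto
  have w: "wt t (Suc N) i = (if i = u then wt t' N i + 1 else wt t' N i)" for i
  proof -
    have "{s \<in> {3..Suc N}. t s = i} = {s \<in> {3..N}. t' s = i} \<union> (if i = u then {Suc N} else {})"
      using Suc.hyps by (auto simp: t)
    then have "card {s \<in> {3..Suc N}. t s = i} = card {s \<in> {3..N}. t' s = i} + (if i = u then 1 else 0)"
      by simp
    then show ?thesis by (simp add: wt_def)
  qed
  have w': "wt t (Suc N) = (wt t' N)(u := wt t' N u + 1)" by (auto simp: w fun_eq_iff)
  have S: "(\<Sum>j = 1..N. wt t' N j) = total N"
    by (rule sum_wt_total[OF t(2) Suc.hyps])
  have "(\<Sum>j = 1..N. wt t (Suc N) j) = total N + 1"
    unfolding w' S[symmetric] using t(3) by (subst (1 2) sum.remove[of "{1..N}" u]) auto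
  moreover have "card {s \<in> {3..N}. t' s = Suc N} = 0"
    using t(2) by (fastforce simp: histories_def dest!: PiE_mem)
  then have "wt t (Suc N) (Suc N) = \<alpha> (Suc N)"
    using t(3) by (subst w) (auto simp: wt_def)
  moreover have "Beta (\<alpha> (Suc N)) (\<beta> (Suc N)) > 0"
    using \<alpha>_pos[of "Suc N"] \<beta>_pos[of "Suc N"] Suc.hyps
    by (auto intro: Beta_real_pos)
  ultimately have last: "Beta (wt t (Suc N) (Suc N)) (\<Sum>j = 1..<Suc N. wt t (Suc N) j)
      / Beta (\<alpha> (Suc N)) (\<beta> (Suc N)) = 1"
    using Suc.hyps by (simp add: \<beta>_Suc atLeastLessThanSuc_atLeastAtMost)
  have "(\<Prod>i = 2..Suc N. Beta (wt t (Suc N) i) (\<Sum>u = 1..<i. wt t (Suc N) u) / Beta (\<alpha> i) (\<beta> i))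
      = (\<Prod>i = 2..N. Beta (wt t (Suc N) i) (\<Sum>u = 1..<i. wt t (Suc N) u) / Beta (\<alpha> i) (\<beta> i))"
    by (subst prod.nat_ivl_Suc', use Suc.hyps in simp, subst last, simp)
  also have "\<dots> = (\<Prod>i = 2..N. Beta (wt t' N i) (\<Sum>u = 1..<i. wt t' N u) / Beta (\<alpha> i) (\<beta> i))
       * (wt t' N u / total N)"
    using prod_Beta_upd[of "wt t' N" N u] wt_pos Suc.hyps t(3) S
    by (simp add: w' prod_dividef)
  also have "\<dots> = pmf (hist_pmf (Suc N)) t"
    unfolding t(1) pmf_hist_Suc[OF Suc.hyps t(2,3)] using Suc.IH[OF t(2)] by simp
  finally show ?case by simp
qed

end

section \<open>The urn graph\<close>

text \<open>Under these conditions the positions with index in \<open>{1..N}\<close> are positive,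
  so they may be divided by, and the convention that position 0 is 0 agrees with the product
  formula, whose factor \<open>1 - \<psi> 1\<close> vanishes.\<close>

definition proper :: "nat \<Rightarrow> (nat \<Rightarrow> real) \<Rightarrow> bool" where
  "proper N \<psi> \<longleftrightarrow> \<psi> 1 = 1 \<and> (\<forall>i\<in>{2..N}. \<psi> i \<in> {0<..<1})"

text \<open>The urn interval of \<open>u\<close> divided by \<open>S\<^bsub>s-1\<^esub>\<close>; its lower end is 0 for \<open>u = 1\<close> because \<open>\<psi>\<^sub>1 = 1\<close>.\<close>

definition cell :: "(nat \<Rightarrow> real) \<Rightarrow> nat \<Rightarrow> nat \<Rightarrow> real set" where
  "cell \<psi> s u = {\<Prod>i = u..<s. 1 - \<psi> i ..< \<Prod>i = Suc u..<s. 1 - \<psi> i}"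

text \<open>Divided by the position of \<open>s - 1\<close>, the urn intervals become the cells.
  Their end points increase with the index, so the cells are disjoint and the description by
  \<open>THE\<close> has the unique solution \<open>u\<close>.\<close>

lemma urn_target_eqI:
  assumes \<psi>: "proper N \<psi>" and s: "s \<in> {3..N}" and u: "u \<in> {1..s - 1}" and U: "U s \<in> cell \<psi> s u"
  shows "urn_target N \<psi> U s = u"
proof -
  \<comment> \<open>\<open>c\<close> is \<open>urn_pos N \<psi> (s - 1)\<close>, and
    \<open>D v\<close> is the position of \<open>v\<close> divided by \<open>c\<close>.\<close>
  define D where "D v = (\<Prod>i = Suc v..<s. 1 - \<psi> i)" for v
  define c where "c = (\<Prod>i = s..N. 1 - \<psi> i)"
  have c: "c > 0" unfolding c_def using \<psi> s by (intro prod_pos) (auto simp: proper_def)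
  have pos: "urn_pos N \<psi> v = D v * c" if "v \<le> s - 1" for v
  proof (cases "v = 0")
    case True
    have "D 0 = 0" using s \<psi> by (auto simp: D_def proper_def)
    then show ?thesis using True by (simp add: urn_pos_def)
  next
    case False
    have "{v + 1..N} = {Suc v..<s} \<union> {s..N}" using that s by auto
    then show ?thesis using False unfolding urn_pos_def D_def c_def
      by (simp add: prod.union_disjoint[symmetric] ivl_disj_int)
  qed
  have mem: "U s * urn_pos N \<psi> (s - 1) \<in> urn_interval N \<psi> v \<longleftrightarrow> D (v - 1) \<le> U s \<and> U s < D v"
    if "v \<in> {1..s - 1}" for v
    using that c pos[of "s - 1"] pos[of v] pos[of "v - 1"] s
    by (auto simp: urn_interval_def D_def)
  have mono: "D v \<le> D w" if "v \<le> w" "w \<le> s - 1" for v w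
  \<comment> \<open>The factor with index 1 is 0; factors lie strictly between 0 and 1 only from
    index 2 on.\<close>
  proof (cases "v = 0")
    case True
    have "D 0 = 0" using s \<psi> by (auto simp: D_def proper_def)
    moreover have "D w \<ge> 0" unfolding D_def using \<psi> s
      by (intro prod_nonneg) (force simp: proper_def not_less_eq_eq le_Suc_eq intro: less_imp_le)
    ultimately show ?thesis using True by simp
  next
    case False
    have i: "0 < 1 - \<psi> i \<and> 1 - \<psi> i < 1" if "i \<in> {Suc v..<s}" for i
      using \<psi> s that False by (auto simp: proper_def)
    have "{Suc v..<s} = {Suc v..<Suc w} \<union> {Suc w..<s}" using that s by auto
    then have "D v = (\<Prod>i = Suc v..<Suc w. 1 - \<psi> i) * D w" unfolding D_def
      by (simp add: prod.union_disjoint[symmetric] ivl_disj_int del: prod.op_ivl_Suc)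
    moreover have "(\<Prod>i = Suc v..<Suc w. 1 - \<psi> i) \<le> 1" 
      using i that s by (intro prod_le_1) (auto simp: less_imp_le)
    moreover have "D w \<ge> 0" unfolding D_def using i that
      by (intro prod_nonneg) (auto simp: less_imp_le)
    ultimately show ?thesis
      using mult_right_mono[of "\<Prod>i = Suc v..<Suc w. 1 - \<psi> i" 1 "D w"] by simp
  qed
  have "D (u - 1) \<le> U s" "U s < D u" using U u by (auto simp: cell_def D_def)
  then show ?thesis
    unfolding urn_target_def
  proof (intro the_equality conjI)
    fix v assume v: "v \<in> {1..s - 1} \<and> U s * urn_pos N \<psi> (s - 1) \<in> urn_interval N \<psi> v"
    then have "D (v - 1) \<le> U s" "U s < D v" using mem[of v] by auto
    moreover have "D v \<le> D (u - 1)" if "v < u" using that u by (intro mono) auto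
    moreover have "D u \<le> D (v - 1)" if "u < v" using that v by (intro mono) auto
    ultimately show "v = u"
      using \<open>D (u - 1) \<le> U s\<close> \<open>U s < D u\<close> by (cases v u rule: linorder_cases) force+
  qed (use u mem in auto)
qed

section \<open>Joint law of the urn variables and the probability of a cell event\<close>

context urn_weights begin

text \<open>Index 0 gets a dummy point mass because \<open>product_prob_space\<close> asks for a
  probability measure at every index, also outside the index set.\<close>

definition psi_law :: "nat \<Rightarrow> real measure" where
  "psi_law s = (if s \<le> 1 then return borel 1 else beta_measure (\<alpha> s) (\<beta> s))"

lemma sets_psi_law [measurable_cong, simp]: "sets (psi_law s) = sets borel"
  by (simp add: psi_law_def)

lemma prob_space_psi_law: "prob_space (psi_law s)"
  unfolding psi_law_def using \<alpha>_pos[of s] \<beta>_pos[of s]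
  by (auto intro!: prob_space_return prob_space_beta_measure)

abbreviation unif :: "real measure" where "unif \<equiv> uniform_measure lborel {0..1}"

definition law :: "((nat \<Rightarrow> real) \<times> (nat \<Rightarrow> real)) measure" where
  "law = (\<Pi>\<^sub>M s\<in>{1..}. psi_law s) \<Otimes>\<^sub>M (\<Pi>\<^sub>M s\<in>{1..}. unif)"

sublocale psi: product_prob_space psi_law "{1::nat..}"
  by (rule product_prob_spaceI) (rule prob_space_psi_law)

lemma prob_space_unif: "prob_space unif"
  by (rule prob_space_uniform_measure) auto

sublocale U: product_prob_space "\<lambda>_::nat. unif" "{1::nat..}"
  by (rule product_prob_spaceI) (rule prob_space_unif)

sublocale law: prob_space law
proof -
  interpret pair_prob_space "\<Pi>\<^sub>M s\<in>{1..}. psi_law s" "\<Pi>\<^sub>M s\<in>{1::nat..}. unif" ..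
  show "prob_space law" unfolding law_def by (rule P.prob_space_axioms)
qed


text \<open>Imposing \<open>proper\<close> at every point, not just almost surely, makes the targets
  equal to \<open>t\<close> on the whole event.\<close>

definition cell_event :: "nat \<Rightarrow> (nat \<Rightarrow> nat) \<Rightarrow> ((nat \<Rightarrow> real) \<times> (nat \<Rightarrow> real)) set" where
  "cell_event N t = {x \<in> space law. proper N (fst x) \<and> (\<forall>s\<in>{3..N}. snd x s \<in> cell (fst x) s (t s))}"

lemma measurable_psi [measurable]:
  "i \<ge> 1 \<Longrightarrow> (\<lambda>x. fst x i) \<in> borel_measurable law"
  unfolding law_def by (auto intro!: measurable_compose[OF measurable_fst] measurable_component_singleton
    simp: measurable_cong_sets[OF refl sets_psi_law, symmetric])

lemma measurable_U [measurable]: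
  "i \<ge> 1 \<Longrightarrow> (\<lambda>x. snd x i) \<in> borel_measurable law"
  unfolding law_def by (auto intro!: measurable_compose[OF measurable_snd] measurable_component_singleton
    simp: measurable_cong_sets[OF refl sets_uniform_measure, of lborel, symmetric])

lemma cell_event_sets:
  assumes t: "t \<in> histories N"
  shows "cell_event N t \<in> sets law"
proof -
  have t: "t s \<ge> 1" if "s \<in> {3..N}" for s
    using t that by (auto simp: histories_def dest!: PiE_mem)
  have [measurable]: "Measurable.pred law (\<lambda>x. snd x s \<in> cell (fst x) s (t s))" if "s \<in> {3..N}" for s
  proof -
    have [measurable]: "(\<lambda>x. \<Prod>i = t s..<s. 1 - fst x i) \<in> borel_measurable law"
      "(\<lambda>x. \<Prod>i = Suc (t s)..<s. 1 - fst x i) \<in> borel_measurable law"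
      "(\<lambda>x. snd x s) \<in> borel_measurable law"
      using t[OF that] that
      by (auto intro!: borel_measurable_prod borel_measurable_diff measurable_psi)
    show ?thesis unfolding cell_def atLeastLessThan_iff by measurable
  qed
  have "Measurable.pred law (\<lambda>x. fst x i \<in> {0<..<1})" if "i \<in> {2..N}" for i
  proof -
    have [measurable]: "(\<lambda>x. fst x i) \<in> borel_measurable law" using that by auto
    show ?thesis by measurable
  qed
  then have [measurable]: "Measurable.pred law (\<lambda>x. \<forall>i\<in>{2..N}. fst x i \<in> {0<..<1})"
    by (intro pred_intros_finite) auto
  have [measurable]: "Measurable.pred law (\<lambda>x. \<forall>s\<in>{3..N}. snd x s \<in> cell (fst x) s (t s))"
    by (intro pred_intros_finite) auto
  show ?thesis unfolding cell_event_def proper_def by measurable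
qed

text \<open>The lower end of the cell is \<open>1 - \<psi> u\<close> times its upper end, and the
  cell lies in the unit interval, so its uniform measure is the difference of the ends.\<close>

lemma emeasure_cell:
  assumes \<psi>: "proper N \<psi>" and s: "s \<in> {3..N}" and u: "u \<in> {1..s - 1}"
  shows "emeasure unif (cell \<psi> s u) = ennreal (\<psi> u * (\<Prod>i = Suc u..<s. 1 - \<psi> i))"
proof -
  have i: "0 < 1 - \<psi> i \<and> 1 - \<psi> i < 1" if "i \<in> {Suc u..<s}" for i
    using \<psi> s u that by (auto simp: proper_def)
  have "u = 1 \<or> u \<in> {2..N}" using u s by auto
  then have iu: "0 \<le> 1 - \<psi> u" "0 \<le> \<psi> u"
    using \<psi> by (auto simp: proper_def less_imp_le)
  let ?P = "\<Prod>i = Suc u..<s. 1 - \<psi> i"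
  have P: "0 \<le> ?P" "?P \<le> 1" using i by (auto intro!: prod_nonneg prod_le_1 simp: less_imp_le)
  have lo: "(\<Prod>i = u..<s. 1 - \<psi> i) = (1 - \<psi> u) * ?P"
    using u s by (subst prod.atLeast_Suc_lessThan) auto
  have le: "0 \<le> (1 - \<psi> u) * ?P" "(1 - \<psi> u) * ?P \<le> ?P" 
    using iu P by (auto intro!: mult_nonneg_nonneg simp: mult_left_le_one_le)
  have "{0..1} \<inter> {(1 - \<psi> u) * ?P..<?P} = {(1 - \<psi> u) * ?P..<?P}"
    using le P by auto
  then show ?thesis
    unfolding cell_def lo using le
    by (subst emeasure_uniform_measure) (auto simp: algebra_simps divide_ennreal_def)
qed

text \<open>Exchanging the products over \<open>s\<close> and \<open>i\<close>:
  \<open>\<psi> i\<close> occurs once for each edge into \<open>i\<close>, and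
  \<open>1 - \<psi> i\<close> once for each edge that passes over \<open>i\<close>.\<close>

lemma cell_size_prod:
  assumes t: "t \<in> histories N"
  shows "(\<Prod>s = 3..N. \<psi> (t s) * (\<Prod>i = Suc (t s)..<s. 1 - \<psi> i)) =
    (\<Prod>i = 1..N. \<psi> i ^ card {s\<in>{3..N}. t s = i} * (1 - \<psi> i :: real) ^ card {s\<in>{3..N}. t s < i \<and> i < s})"
proof -
  have t: "1 \<le> t s \<and> t s < s" if "s \<in> {3..N}" for s
    using t that by (fastforce simp: histories_def dest!: PiE_mem)
  have "\<psi> (t s) * (\<Prod>i = Suc (t s)..<s. 1 - \<psi> i) =
     (\<Prod>i = 1..N. (if t s = i then \<psi> i else 1) * (if t s < i \<and> i < s then 1 - \<psi> i else 1))"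
    if s: "s \<in> {3..N}" for s
  proof -
    have "{i \<in> {1..N}. t s < i \<and> i < s} = {Suc (t s)..<s}" using t[OF s] s by auto
    then show ?thesis
      using t[OF s] s unfolding prod.distrib
      by (simp add: prod.inter_filter[symmetric] del: prod.inter_restrict)
  qed
  then have "(\<Prod>s = 3..N. \<psi> (t s) * (\<Prod>i = Suc (t s)..<s. 1 - \<psi> i)) =
     (\<Prod>i = 1..N. \<Prod>s = 3..N. (if t s = i then \<psi> i else 1) * (if t s < i \<and> i < s then 1 - \<psi> i else 1))"
    by (subst prod.swap) simp
  then show ?thesis
    by (simp add: prod.distrib prod.inter_filter[symmetric])
qed

text \<open>By Fubini the variables \<open>U s\<close> are integrated out first, leaving a product
  of cell lengths. Regrouped by \<open>i\<close> it is a product of functions of the independent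
  \<open>\<psi> i\<close>, whose integrals are Beta ratios.\<close>

lemma measure_cell_event:
  assumes t: "t \<in> histories N" and N: "N \<ge> 2"
  shows "measure law (cell_event N t) = pmf (hist_pmf N) t"
proof -
  define p where "p i = card {s\<in>{3..N}. t s = i}" for i
  define q where "q i = card {s\<in>{3..N}. t s < i \<and> i < s}" for i
  \<comment> \<open>The indicators make the product of the \<open>f i\<close> vanish off
    \<open>proper\<close>, so that the formula for the slices holds for every \<psi>.\<close>
  define f :: "nat \<Rightarrow> real \<Rightarrow> ennreal" where
    "f i x = (if i = 1 then indicator {1} x else ennreal (x ^ p i * (1 - x) ^ q i) * indicator {0<..<1} x)" for i x
  have t': "t s \<in> {1..s - 1}" if "s \<in> {3..N}" for s
    using t that by (auto simp: histories_def dest!: PiE_mem)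
  have [measurable]: "f i \<in> borel_measurable (psi_law i)" for i
    unfolding measurable_cong_sets[OF sets_psi_law refl] f_def by measurable
  have slice: "emeasure (\<Pi>\<^sub>M s\<in>{1::nat..}. unif) (Pair \<psi> -` cell_event N t) = (\<Prod>i = 1..N. f i (\<psi> i))"
    if \<psi>: "\<psi> \<in> space (\<Pi>\<^sub>M s\<in>{1..}. psi_law s)" for \<psi>
  proof (cases "proper N \<psi>")
    case False
    then have "Pair \<psi> -` cell_event N t = {}" by (auto simp: cell_event_def)
    moreover obtain i where "i \<in> {1..N}" "f i (\<psi> i) = 0"
    proof (cases "\<psi> 1 = 1")
      case True
      with False obtain i where "i \<in> {2..N}" "\<psi> i \<notin> {0<..<1}" by (auto simp: proper_def)
      then show ?thesis by (intro that[of i]) (auto simp: f_def)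
    next
      case False
      then show ?thesis using N by (intro that[of 1]) (auto simp: f_def)
    qed
    ultimately show ?thesis by (metis emeasure_empty finite_atLeastAtMost prod_zero)
  next
    case True
    have "Pair \<psi> -` cell_event N t =
        {U \<in> space (\<Pi>\<^sub>M s\<in>{1::nat..}. unif). \<forall>s\<in>{3..N}. U s \<in> cell \<psi> s (t s)}"
      using True \<psi> by (auto simp: cell_event_def law_def space_pair_measure)
    then have "emeasure (\<Pi>\<^sub>M s\<in>{1::nat..}. unif) (Pair \<psi> -` cell_event N t)
        = (\<Prod>s = 3..N. emeasure unif (cell \<psi> s (t s)))"
      by (simp only:) (subst U.emeasure_PiM_Collect, auto simp: cell_def)
    also have "\<dots> = (\<Prod>s = 3..N. ennreal (\<psi> (t s) * (\<Prod>i = Suc (t s)..<s. 1 - \<psi> i)))"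
      using True t' by (intro prod.cong refl emeasure_cell) auto
    also have "\<dots> = ennreal (\<Prod>s = 3..N. \<psi> (t s) * (\<Prod>i = Suc (t s)..<s. 1 - \<psi> i))"
    proof (intro prod_ennreal mult_nonneg_nonneg prod_nonneg ballI)
      fix s assume s: "s \<in> {3..N}"
      have "t s = 1 \<or> t s \<in> {2..N}" using t'[OF s] s by auto
      then show "0 \<le> \<psi> (t s)" using True by (auto simp: proper_def less_imp_le)
      show "0 \<le> 1 - \<psi> i" if "i \<in> {Suc (t s)..<s}" for i
        using True t'[OF s] s that by (auto simp: proper_def less_imp_le)
    qed
    also have "\<dots> = ennreal (\<Prod>i = 1..N. \<psi> i ^ p i * (1 - \<psi> i) ^ q i)"
      unfolding cell_size_prod[OF t] p_def q_def ..
    also have "\<dots> = (\<Prod>i = 1..N. ennreal (\<psi> i ^ p i * (1 - \<psi> i) ^ q i))"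
    proof (intro prod_ennreal[symmetric] mult_nonneg_nonneg zero_le_power)
      fix i assume "i \<in> {1..N}"
      then have "i = 1 \<or> i \<in> {2..N}" by auto
      then show "0 \<le> \<psi> i" "0 \<le> 1 - \<psi> i" using True by (auto simp: proper_def less_imp_le)
    qed
    also have "\<dots> = (\<Prod>i = 1..N. f i (\<psi> i))"
    proof (intro prod.cong refl)
      fix i assume i: "i \<in> {1..N}"
      \<comment> \<open>No edge passes over vertex 1, so the vanishing \<open>1 - \<psi> 1\<close>
        occurs with exponent 0 and the factor is 1.\<close>
      have "q 1 = 0" using t' by (force simp: q_def)
      then show "ennreal (\<psi> i ^ p i * (1 - \<psi> i) ^ q i) = f i (\<psi> i)"
        using True i by (cases "i = 1") (auto simp: f_def proper_def)
    qed
    finally show ?thesis .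
  qed
  have "emeasure law (cell_event N t) = (\<integral>\<^sup>+\<psi>. (\<Prod>i = 1..N. f i (\<psi> i)) \<partial>(\<Pi>\<^sub>M s\<in>{1..}. psi_law s))"
    using cell_event_sets[OF t] unfolding law_def
    by (subst U.P.emeasure_pair_measure_alt, assumption) (rule nn_integral_cong, rule slice)
  also have "\<dots> = (\<integral>\<^sup>+\<psi>. (\<Prod>i = 1..N. f i (restrict \<psi> {1..N} i)) \<partial>(\<Pi>\<^sub>M s\<in>{1..}. psi_law s))"
    by (intro nn_integral_cong prod.cong) auto
  also have "\<dots> = (\<integral>\<^sup>+\<psi>. (\<Prod>i = 1..N. f i (\<psi> i)) \<partial>(\<Pi>\<^sub>M s\<in>{1..N}. psi_law s))"
    by (subst psi.distr_PiM_restrict_finite[symmetric, of "{1..N}"], simp, force)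
       (subst nn_integral_distr, auto intro!: measurable_restrict_subset)
  also have "\<dots> = (\<Prod>i = 1..N. \<integral>\<^sup>+x. f i x \<partial>psi_law i)"
    by (rule psi.product_nn_integral_prod) auto
  also have "\<dots> = (\<Prod>i = 2..N. \<integral>\<^sup>+x. f i x \<partial>psi_law i)"
  proof -
    have "{1..N} = insert 1 {2..N}" using N by auto
    moreover have "(\<integral>\<^sup>+x. f 1 x \<partial>psi_law 1) = 1"
      by (simp add: psi_law_def f_def nn_integral_return)
    ultimately show ?thesis by simp
  qed
  also have "\<dots> = (\<Prod>i = 2..N. ennreal (Beta (wt t N i) (\<Sum>u = 1..<i. wt t N u) / Beta (\<alpha> i) (\<beta> i)))"
  proof (intro prod.cong refl)
    fix i assume i: "i \<in> {2..N}"
    have "(\<Sum>u = 1..<i. wt t N u) = \<beta> i + real (q i)"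
      using sum_wt[OF t, of i] i by (simp add: \<beta>_def q_def)
    moreover have "wt t N i = \<alpha> i + real (p i)" by (simp add: wt_def p_def)
    ultimately show "(\<integral>\<^sup>+x. f i x \<partial>psi_law i) = ennreal (Beta (wt t N i) (\<Sum>u = 1..<i. wt t N u) / Beta (\<alpha> i) (\<beta> i))"
      using nn_integral_beta_measure[of "\<alpha> i" "\<beta> i" "p i" "q i"] \<alpha>_pos[of i] \<beta>_pos[of i] i
      by (simp add: f_def psi_law_def)
  qed
  also have "\<dots> = ennreal (pmf (hist_pmf N) t)"
    unfolding pmf_hist_pmf[OF N t]
  proof (intro prod_ennreal divide_nonneg_nonneg)
    fix i assume i: "i \<in> {2..N}"
    have "(\<Sum>u = 1..<i. wt t N u) > 0" using i by (intro sum_pos wt_pos) auto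
    then show "0 \<le> Beta (wt t N i) (\<Sum>u = 1..<i. wt t N u)" "0 \<le> Beta (\<alpha> i) (\<beta> i)"
      using i wt_pos[of i t N] \<alpha>_pos[of i] \<beta>_pos[of i]
      by (auto intro!: less_imp_le[OF Beta_real_pos])
  qed
  finally show ?thesis by (simp add: measure_def)
qed

section \<open>From cell events to the law of the targets\<close>

lemma cell_event_target:
  assumes "t \<in> histories N" "x \<in> cell_event N t"
  shows "restrict (urn_target N (fst x) (snd x)) {3..N} = t"
proof
  fix s
  show "restrict (urn_target N (fst x) (snd x)) {3..N} s = t s"
  proof (cases "s \<in> {3..N}")
    case True
    then have "t s \<in> {1..s - 1}" using assms(1) by (auto simp: histories_def dest!: PiE_mem)
    then show ?thesis using urn_target_eqI[of N "fst x" s "t s" "snd x"] assms(2) True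
      by (auto simp: cell_event_def)
  next
    case False
    then show ?thesis using assms(1) by (auto simp: histories_def PiE_def extensional_def)
  qed
qed

text \<open>The target is a function of the finite set \<open>Q x\<close> of admissible indices, and
  each event \<open>Q x = A\<close> is a finite combination of inequalities. This works even where
  \<open>THE\<close> has no unique solution.\<close>

lemma measurable_urn_target:
  assumes "s \<in> {3..N}"
  shows "(\<lambda>x. urn_target N (fst x) (snd x) s) \<in> measurable law (count_space UNIV)"
proof -
  have [measurable]: "(\<lambda>x. urn_pos N (fst x) i) \<in> borel_measurable law" for i
    unfolding urn_pos_def
    by (cases "i = 0") (auto intro!: borel_measurable_prod borel_measurable_diff measurable_psi)
  have [measurable]: "(\<lambda>x. snd x s) \<in> borel_measurable law" using assms by auto
  define Q where "Q x = {u \<in> {1..s - 1}. snd x s * urn_pos N (fst x) (s - 1) \<in> urn_interval N (fst x) u}" for x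
  have "Measurable.pred law (\<lambda>x. Q x = A)" for A
  proof -
    have "Q x = A \<longleftrightarrow> A \<subseteq> {1..s - 1} \<and> (\<forall>u\<in>{1..s - 1}. u \<in> A \<longleftrightarrow>
        urn_pos N (fst x) (u - 1) \<le> snd x s * urn_pos N (fst x) (s - 1) \<and>
        snd x s * urn_pos N (fst x) (s - 1) < urn_pos N (fst x) u)" for x
      by (auto simp: Q_def urn_interval_def)
    then show ?thesis by simp
  qed
  then have "Q \<in> measurable law (count_space (Pow {1..s - 1}))"
    by (intro measurable_count_space_eq2[THEN iffD2]) (auto simp: Q_def vimage_def Int_def pred_def conj_commute)
  then have "(\<lambda>x. (\<lambda>A. THE u. u \<in> A) (Q x)) \<in> measurable law (count_space UNIV)"
    by (rule measurable_compose) simp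
  then show ?thesis by (simp add: urn_target_def Q_def)
qed

text \<open>Finitely many coordinates with countably many values carry the discrete sigma-algebra,
  so an arbitrary predicate \<open>F\<close> is allowed.\<close>

lemma target_event_sets:
  "{x \<in> space law. F (restrict (urn_target N (fst x) (snd x)) {3..N})} \<in> sets law"
proof -
  let ?X = "\<lambda>x. restrict (urn_target N (fst x) (snd x)) {3..N}"
  have "?X \<in> measurable law (PiM {3..N} (\<lambda>_. count_space UNIV))"
    by (intro measurable_restrict measurable_urn_target)
  then have X: "?X \<in> measurable law (count_space (PiE {3..N} (\<lambda>_. UNIV)))"
    by (simp add: count_space_PiM_finite)
  have "?X -` {t \<in> PiE {3..N} (\<lambda>_. UNIV). F t} \<inter> space law \<in> sets law"
    by (rule measurable_sets[OF X]) auto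
  also have "?X -` {t \<in> PiE {3..N} (\<lambda>_. UNIV). F t} \<inter> space law = {x \<in> space law. F (?X x)}"
    by auto
  finally show ?thesis .
qed

text \<open>The cell events of the histories satisfying \<open>F\<close> are disjoint, as each
  determines its targets; they lie in the event on the left and their probabilities add up to the
  right-hand side.\<close>

lemma target_event_ge:
  assumes "N \<ge> 2"
  shows "measure law {x \<in> space law. F (restrict (urn_target N (fst x) (snd x)) {3..N})}
     \<ge> measure_pmf.prob (hist_pmf N) {t. F t}"
proof -
  have "measure_pmf.prob (hist_pmf N) {t. F t} = measure_pmf.prob (hist_pmf N) {t \<in> histories N. F t}"
    using set_hist_pmf[OF assms] by (intro measure_pmf.finite_measure_eq_AE) (auto simp: AE_measure_pmf_iff)
  also have "\<dots> = (\<Sum>t | t \<in> histories N \<and> F t. pmf (hist_pmf N) t)"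
    using finite_histories by (intro measure_measure_pmf_finite) auto
  also have "\<dots> = (\<Sum>t | t \<in> histories N \<and> F t. measure law (cell_event N t))"
    using assms by (intro sum.cong) (auto simp: measure_cell_event)
  also have "\<dots> = measure law (\<Union>t\<in>{t\<in>histories N. F t}. cell_event N t)"
  proof (intro law.finite_measure_finite_Union[symmetric])
    show "finite {t \<in> histories N. F t}" using finite_histories by auto
    show "cell_event N ` {t \<in> histories N. F t} \<subseteq> sets law" using cell_event_sets by auto
    show "disjoint_family_on (cell_event N) {t \<in> histories N. F t}"
      unfolding disjoint_family_on_def using cell_event_target by blast
  qed
  also have "\<dots> \<le> measure law {x \<in> space law. F (restrict (urn_target N (fst x) (snd x)) {3..N})}"
    using cell_event_target
    by (intro law.finite_measure_mono target_event_sets) (auto simp: cell_event_def)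
  finally show ?thesis .
qed

text \<open>The cell events have total probability 1, so the lower bound, applied also to the negation of \<open>F\<close>,
  is an equality. Hence existence of the neighbour never has to be checked.\<close>

theorem prob_target_event:
  assumes "N \<ge> 2"
  shows "measure law {x \<in> space law. F (restrict (urn_target N (fst x) (snd x)) {3..N})}
     = measure_pmf.prob (hist_pmf N) {t. F t}"
proof (rule antisym)
  let ?X = "\<lambda>x. restrict (urn_target N (fst x) (snd x)) {3..N}"
  have "measure law {x \<in> space law. \<not> F (?X x)} = 1 - measure law {x \<in> space law. F (?X x)}"
    using target_event_sets[of F N] by (rule law.prob_neg)
  moreover have "measure_pmf.prob (hist_pmf N) {t. \<not> F t} = 1 - measure_pmf.prob (hist_pmf N) {t. F t}"
    using measure_pmf.prob_neg[of "hist_pmf N" F] by simp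
  ultimately show "measure law {x \<in> space law. F (?X x)} \<le> measure_pmf.prob (hist_pmf N) {t. F t}"
    using target_event_ge[OF assms, of "\<lambda>t. \<not> F t"] by linarith
qed (rule target_event_ge[OF assms])

end

section \<open>Collapsing groups\<close>

lemma mdegree_add_mset:
  "mdegree (add_mset (Upair a b) H) u = mdegree H u + of_bool (a = u) + of_bool (b = u)"
  by (auto simp: mdegree_def)

lemma mdegree_add_edges:
  "mdegree (H + {#Upair (f s) (g s). s \<in># mset_set A#}) u =
     mdegree H u + card {s\<in>A. f s = u} + card {s\<in>A. g s = u}" if "finite A"
  using that
proof (induction A rule: finite_induct)
  case (insert x A)
  have "{s \<in> insert x A. h s = u} = {s\<in>A. h s = u} \<union> (if h x = u then {x} else {})" for h :: "_ \<Rightarrow> nat"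
    by auto
  then have "card {s \<in> insert x A. h s = u} = card {s\<in>A. h s = u} + of_bool (h x = u)" for h :: "_ \<Rightarrow> nat"
    using insert.hyps by auto
  then show ?case using insert by (simp add: mdegree_add_mset)
qed simp

lemma mdegree_outside:
  assumes "mgraph_on V G" "u \<notin> V"
  shows "mdegree G u = 0"
proof -
  have "{#e \<in># G. u \<in> set_uprod e#} = {#}"
    using assms by (force simp: mgraph_on_def filter_mset_eq_mempty_iff)
  moreover have "Upair u u \<notin># G"
    using assms by (force simp: mgraph_on_def)
  ultimately show ?thesis by (simp add: mdegree_def not_in_iff)
qed

section \<open>Groups as consecutive blocks of urn vertices\<close>

lemma psum_Suc: "psum m (Suc k) = psum m k + m (Suc k)"
  by (simp add: psum_def)

lemma psum_mono: "k \<le> l \<Longrightarrow> psum m k \<le> psum m l"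
  unfolding psum_def by (intro sum_mono2) auto

lemma psum_pred_less_imp_le:
  assumes "psum m (k - 1) < s" "s \<le> psum m l" shows "k \<le> l"
proof (rule ccontr)
  assume "\<not> k \<le> l"
  then have "psum m l \<le> psum m (k - 1)" by (intro psum_mono) auto
  with assms show False by simp
qed

text \<open>One realisation of the edge counts is frozen here. \<open>weight_pos\<close> makes the
  first Beta parameter positive.\<close>

locale collapse =
  fixes \<delta> :: real and G0 :: mgraph and m :: "nat \<Rightarrow> nat"
  assumes m_1: "m 1 = 1" and m_2: "m 2 = 1"
    and m_pos: "i \<ge> 1 \<Longrightarrow> m i \<ge> 1"
    and weight_pos: "i \<ge> 3 \<Longrightarrow> 1 + \<delta> / real (m i) > 0"
    and G0: "mgraph_on {1, 2} G0"
    and init_pos: "real (mdegree G0 1) + \<delta> > 0" "real (mdegree G0 2) + \<delta> > 0"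
begin

abbreviation grp :: "nat \<Rightarrow> nat" where "grp \<equiv> group_of m"

lemma group_of_eqI: "psum m (k - 1) < s \<Longrightarrow> s \<le> psum m k \<Longrightarrow> grp s = k"
  unfolding group_of_def
proof (rule the_equality)
  fix l assume "psum m (k - 1) < s" "s \<le> psum m k" "s \<in> {psum m (l - 1) + 1..psum m l}"
  then show "l = k"
    using psum_pred_less_imp_le[of m k s l] psum_pred_less_imp_le[of m l s k] by simp
qed auto

lemma group_of_obtain:
  assumes "s \<ge> 1"
  obtains k where "k \<ge> 1" "psum m (k - 1) < s" "s \<le> psum m k" "grp s = k"
proof -
  \<comment> \<open>Every group is nonempty, so the first \<open>s\<close> groups reach at least up
    to \<open>s\<close>.\<close>
  have ex: "s \<le> psum m s"
  proof (induction s)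
    case (Suc s)
    then show ?case using m_pos[of "Suc s"] by (simp add: psum_Suc)
  qed simp
  define k where "k = (LEAST k. s \<le> psum m k)"
  have 1: "s \<le> psum m k" unfolding k_def by (rule LeastI[of _ s]) (rule ex)
  have "k \<noteq> 0"
  proof
    assume "k = 0"
    with 1 assms show False by (simp add: psum_def)
  qed
  then have 2: "psum m (k - 1) < s"
    using not_less_Least[of "k - 1" "\<lambda>k. s \<le> psum m k"] by (simp add: k_def not_le)
  show ?thesis using that[of k] 1 2 \<open>k \<noteq> 0\<close> group_of_eqI[of k s] by auto
qed

lemma group_of_iff:
  assumes "s \<ge> 1"
  shows "grp s = k \<longleftrightarrow> psum m (k - 1) < s \<and> s \<le> psum m k"
  using group_of_obtain[OF assms] group_of_eqI by metis

lemma psum_1: "psum m 1 = 1" and psum_2: "psum m 2 = 2"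
  using m_1 m_2 by (simp_all add: psum_def numeral_2_eq_2)

lemma group_of_1: "grp 1 = 1" and group_of_2: "grp 2 = 2"
  using psum_1 psum_2 by (auto intro!: group_of_eqI simp: psum_def)

lemma psum_ge_2: "k \<ge> 2 \<Longrightarrow> psum m k \<ge> 2"
  using psum_mono[of 2 k m] by (simp add: psum_2)

lemma psum_pred_ge_2: "v \<ge> 3 \<Longrightarrow> psum m (v - 1) + j \<ge> 2"
  using psum_ge_2[of "v - 1"] by (simp add: trans_le_add1)

lemma group_of_ge_3:
  assumes "s \<ge> 3" shows "grp s \<ge> 3"
proof -
  obtain k where k: "s \<le> psum m k" "grp s = k" using group_of_obtain[of s] assms by auto
  have "\<not> k \<le> 2" using psum_mono[of k 2 m] k(1) assms by (auto simp: psum_2)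
  with k show ?thesis by simp
qed

text \<open>From vertex 3 on, the 1 is the half-edge sent out. The shift \<open>\<delta>\<close> of
  a collapsed vertex is shared equally by its group, so a group with \<open>j\<close> members
  present carries the shift \<open>j / m k * \<delta>\<close>.\<close>

definition weight :: "nat \<Rightarrow> real" where
  "weight u = (if u \<le> 2 then real (mdegree G0 u) else 1) + \<delta> / real (m (grp u))"

lemma weight_1: "weight 1 = real (mdegree G0 1) + \<delta>" and weight_2: "weight 2 = real (mdegree G0 2) + \<delta>"
  unfolding weight_def group_of_1 group_of_2 m_1 m_2 by simp_all

sublocale urn_weights weight
proof
  fix i :: nat assume "i \<ge> 1"
  then consider "i = 1" | "i = 2" | "i \<ge> 3" by linarith
  then show "weight i > 0"
  proof cases
    case 3
    then show ?thesis using weight_pos[OF group_of_ge_3[OF 3]] by (simp add: weight_def)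
  qed (use init_pos weight_1 weight_2 in auto)
qed

text \<open>This yields the shifts in \<open>attach_pmf\<close>: completed groups hold all their
  shares of \<open>\<delta>\<close>, the group under construction only \<open>j\<close> of
  them.\<close>

lemma card_group:
  assumes "v \<ge> 1" "j \<le> m v"
  shows "card {u\<in>{1..psum m (v - 1) + j}. grp u = k} =
           (if 1 \<le> k \<and> k < v then m k else if k = v then j else 0)"
proof -
  have v: "psum m v = psum m (v - 1) + m v" using psum_Suc[of m "v - 1"] assms by simp
  have *: "{u\<in>{1..psum m (v - 1) + j}. grp u = k} = {psum m (k - 1) + 1..min (psum m k) (psum m (v - 1) + j)}"
  proof (rule set_eqI)
    fix u
    show "u \<in> {u\<in>{1..psum m (v - 1) + j}. grp u = k} \<longleftrightarrow>
        u \<in> {psum m (k - 1) + 1..min (psum m k) (psum m (v - 1) + j)}"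
      using group_of_iff[of u k] by (cases "u \<ge> 1") auto
  qed
  consider "k = 0" | "1 \<le> k" "k < v" | "k = v" | "k > v" by linarith
  then show ?thesis
  proof cases
    case 1
    then show ?thesis unfolding * using assms by (simp add: psum_def)
  next
    case 2
    then have "psum m k \<le> psum m (v - 1)" by (intro psum_mono) auto
    moreover have "psum m k = psum m (k - 1) + m k" using psum_Suc[of m "k - 1"] 2 by simp
    ultimately show ?thesis unfolding * using 2 by simp
  next
    case 3
    then show ?thesis unfolding * using v assms by simp
  next
    case 4
    then have "psum m v \<le> psum m (k - 1)" by (intro psum_mono) auto
    then show ?thesis unfolding * using v assms 4 by simp
  qed
qed

text \<open>Each urn vertex of group \<open>v\<close> adds \<open>2 + \<delta> / m v\<close> to both
  sides: its own weight and 1 for its neighbour. The index is \<open>Suc j\<close> because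
  \<open>j\<close> edges of \<open>v\<close> are already in place.\<close>

lemma total_eq_attach_norm:
  assumes "v \<ge> 3" "j \<le> m v"
  shows "total (psum m (v - 1) + j) = attach_norm \<delta> G0 m v (Suc j)"
  using assms
proof (induction v arbitrary: j rule: nat_induct_at_least)
  have step: "total (psum m (v - 1) + j) = attach_norm \<delta> G0 m v (Suc j)"
    if base: "total (psum m (v - 1)) = attach_norm \<delta> G0 m v 1" and v: "v \<ge> 3" and j: "j \<le> m v" for v j
    using j
  proof (induction j)
    case 0
    then show ?case using base by simp
  next
    case (Suc j)
    have "psum m (v - 1) \<ge> 2" using v by (intro psum_ge_2) auto
    moreover have "psum m v = psum m (v - 1) + m v" using psum_Suc[of m "v - 1"] v by simp
    then have "grp (Suc (psum m (v - 1) + j)) = v" using Suc.prems v by (intro group_of_eqI) auto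
    ultimately have "weight (Suc (psum m (v - 1) + j)) = 1 + \<delta> / m v" by (simp add: weight_def)
    then have "total (psum m (v - 1) + Suc j) = total (psum m (v - 1) + j) + 2 + \<delta> / m v"
      by (simp add: total_def)
    also have "\<dots> = attach_norm \<delta> G0 m v (Suc (Suc j))"
      using Suc m_pos[of v] v by (simp add: attach_norm_def field_simps)
    finally show ?case .
  qed
  {
    case base
    have "total 2 = weight 1 + weight 2" by (simp add: total_def numeral_2_eq_2)
    then have "total (psum m (3 - 1)) = attach_norm \<delta> G0 m 3 1"
      unfolding weight_1 weight_2 by (simp add: attach_norm_def psum_2 init_degree_def)
    from step[OF this] show ?case using base by simp
  next
    case (Suc v)
    have "psum m v = psum m (v - 1) + m v" using psum_Suc[of m "v - 1"] Suc.hyps by simp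
    then have "total (psum m v) = attach_norm \<delta> G0 m v (Suc (m v))" using Suc.IH[of "m v"] by simp
    \<comment> \<open>The \<open>m v\<close> shares make up a full \<open>\<delta>\<close>, so the
      norm for a fictitious edge \<open>m v + 1\<close> of \<open>v\<close> is that for the first
      edge of \<open>Suc v\<close>.\<close>
    also have "\<dots> = attach_norm \<delta> G0 m (Suc v) 1"
      using Suc.hyps m_pos[of v] \<open>psum m v = _\<close> by (simp add: attach_norm_def of_nat_diff field_simps)
    finally have "total (psum m (Suc v - 1)) = attach_norm \<delta> G0 m (Suc v) 1" by simp
    from step[OF this] show ?case using Suc by simp
  }
qed

section \<open>Degrees and attachment probabilities after collapsing\<close>

definition collapsed :: "(nat \<Rightarrow> nat) \<Rightarrow> nat \<Rightarrow> mgraph" where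
  "collapsed t N = G0 + {#Upair (grp (t s)) (grp s). s \<in># mset_set {3..N}#}"

text \<open>Edges sent by the group are counted by the 1 in \<open>weight\<close>, edges received by
  \<open>wt\<close>. A self-loop is counted both ways, matching its contribution 2 to the
  degree.\<close>

lemma sum_wt_group:
  assumes t: "t \<in> histories N" and N: "N \<ge> 2"
  shows "(\<Sum>u | u \<in> {1..N} \<and> grp u = k. wt t N u) =
    real (mdegree (collapsed t N) k) + real (card {u\<in>{1..N}. grp u = k}) / real (m k) * \<delta>"
proof -
  let ?A = "{u\<in>{1..N}. grp u = k}"
  have tN: "t s \<in> {1..N}" if "s \<in> {3..N}" for s
    using t that by (fastforce simp: histories_def dest!: PiE_mem)
  have eq: "?A = {u\<in>{1, 2}. grp u = k} \<union> {u\<in>{3..N}. grp u = k}" using N by auto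
  have "(\<Sum>u\<in>?A. if u \<le> 2 then real (mdegree G0 u) else 1) =
      (\<Sum>u | u \<in> {1, 2} \<and> grp u = k. real (mdegree G0 u)) + real (card {u\<in>{3..N}. grp u = k})"
    unfolding eq by (subst sum.union_disjoint) (auto intro!: sum.cong)
  also have "(\<Sum>u | u \<in> {1, 2} \<and> grp u = k. real (mdegree G0 u)) = real (mdegree G0 k)"
  proof -
    have "{u \<in> {1, 2}. grp u = k} = (if k \<in> {1, 2} then {k} else {})"
      using group_of_1 group_of_2 by auto
    then show ?thesis using mdegree_outside[OF G0, of k] by simp
  qed
  finally have \<alpha>: "sum weight ?A = real (mdegree G0 k) + real (card {u\<in>{3..N}. grp u = k})
      + real (card ?A) / real (m k) * \<delta>"
    by (simp add: weight_def sum.distrib)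
  have "{s\<in>{3..N}. t s \<in> ?A} = {s\<in>{3..N}. grp (t s) = k}" using tN by auto
  then have "(\<Sum>u\<in>?A. real (card {s\<in>{3..N}. t s = u})) = real (card {s\<in>{3..N}. grp (t s) = k})"
    by (subst sum_card_fibres) auto
  then show ?thesis
    unfolding wt_def sum.distrib collapsed_def using \<alpha> by (subst mdegree_add_edges) auto
qed

text \<open>The group of the new neighbour depends on the history only through the collapsed graph:
  \<open>sum_wt_group\<close> and \<open>card_group\<close> give the numerators,
  \<open>total_eq_attach_norm\<close> the denominator.\<close>

lemma attach_pmf_collapsed:
  assumes v: "v \<ge> 3" and j: "j < m v" and t: "t \<in> histories (psum m (v - 1) + j)"
  shows "attach_pmf \<delta> G0 m v (Suc j) (collapsed t (psum m (v - 1) + j)) =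
           map_pmf grp (step_pmf t (psum m (v - 1) + j))"
proof -
  define N where "N = psum m (v - 1) + j"
  have N: "N \<ge> 2" unfolding N_def using psum_pred_ge_2[OF v] .
  have tot: "total N = attach_norm \<delta> G0 m v (Suc j)"
    unfolding N_def using v j by (intro total_eq_attach_norm) auto
  have card: "card {u\<in>{1..N}. grp u = k} = (if 1 \<le> k \<and> k < v then m k else if k = v then j else 0)" for k
    unfolding N_def using v j by (intro card_group) auto
  note t = t[folded N_def]
  have eq: "pmf (map_pmf grp (step_pmf t N)) k =
     (if 1 \<le> k \<and> k < v then (real (mdegree (collapsed t N) k) + \<delta>) / attach_norm \<delta> G0 m v (Suc j)
     else if k = v then
       (real (mdegree (collapsed t N) v) + (real (Suc j) - 1) / real (m v) * \<delta>) / attach_norm \<delta> G0 m v (Suc j)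
     else 0)" for k
  proof -
    have "pmf (map_pmf grp (step_pmf t N)) k = measure_pmf.prob (step_pmf t N) {u\<in>{1..N}. grp u = k}"
      unfolding pmf_map
      by (intro measure_pmf.finite_measure_eq_AE)
         (auto simp: AE_measure_pmf_iff set_pmf_iff pmf_step_pmf[OF t N] split: if_splits)
    also have "\<dots> = (\<Sum>u | u \<in> {1..N} \<and> grp u = k. wt t N u / total N)"
      by (subst measure_measure_pmf_finite) (auto simp: pmf_step_pmf[OF t N] intro!: sum.cong)
    also have "\<dots> = (\<Sum>u | u \<in> {1..N} \<and> grp u = k. wt t N u) / total N"
      by (simp add: sum_divide_distrib)
    finally have *: "pmf (map_pmf grp (step_pmf t N)) k = \<dots>" .
    show ?thesis
    proof (cases "1 \<le> k \<and> k \<le> v")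
      case True
      then show ?thesis unfolding * sum_wt_group[OF t N] card tot using m_pos[of k] by auto
    next
      case False
      then have "card {u\<in>{1..N}. grp u = k} = 0" unfolding card using v by auto
      then have empty: "{u\<in>{1..N}. grp u = k} = {}" by (subst (asm) card_0_eq) auto
      show ?thesis unfolding * empty using False v by auto
    qed
  qed
  \<comment> \<open>The argument of \<open>embed_pmf\<close> is already the mass function of a pmf,
    so the normalisation of model (B) needs no separate check.\<close>
  show ?thesis
    unfolding attach_pmf_def N_def[symmetric] eq[symmetric]
    by (rule type_definition.Rep_inverse[OF td_pmf_embed_pmf])
qed

lemma collapsed_upd:
  assumes "N \<ge> 2" shows "collapsed (t(Suc N := u)) (Suc N) = add_mset (Upair (grp u) (grp (Suc N))) (collapsed t N)"
proof -
  have "{3..Suc N} = insert (Suc N) {3..N}" using assms by auto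
  moreover have "{#Upair (grp ((t(Suc N := u)) s)) (grp s). s \<in># mset_set {3..N}#} =
      {#Upair (grp (t s)) (grp s). s \<in># mset_set {3..N}#}"
    by (rule image_mset_cong) auto
  ultimately show ?thesis by (simp add: collapsed_def)
qed

text \<open>The edges of \<open>v\<close> correspond in order to the urn vertices
  \<open>s + 1, ..., s + m v\<close>, so \<open>attach_pmf_collapsed\<close> can be
  iterated.\<close>

lemma attach_edges_collapsed:
  assumes v: "v \<ge> 3" and j: "j \<le> m v"
  defines "s \<equiv> psum m (v - 1)"
  shows "bind_pmf (map_pmf (\<lambda>t. collapsed t s) (hist_pmf s)) (\<lambda>H. attach_edges \<delta> G0 m v H j) =
           map_pmf (\<lambda>t. collapsed t (s + j)) (hist_pmf (s + j))"
  using j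
proof (induction j)
  case 0
  then show ?case by (simp add: bind_return_pmf')
next
  case (Suc j)
  have s: "s + j \<ge> 2" unfolding s_def using psum_pred_ge_2[OF v] .
  have "psum m v = s + m v" using psum_Suc[of m "v - 1"] v by (simp add: s_def)
  then have grp: "grp (Suc (s + j)) = v" using Suc.prems v by (intro group_of_eqI) (auto simp: s_def)
  have "bind_pmf (map_pmf (\<lambda>t. collapsed t s) (hist_pmf s)) (\<lambda>H. attach_edges \<delta> G0 m v H (Suc j)) =
    bind_pmf (bind_pmf (map_pmf (\<lambda>t. collapsed t s) (hist_pmf s)) (\<lambda>H. attach_edges \<delta> G0 m v H j))
      (\<lambda>H'. map_pmf (\<lambda>u. add_mset (Upair u v) H') (attach_pmf \<delta> G0 m v (Suc j) H'))"
    by (simp add: bind_assoc_pmf)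
  also have "\<dots> = bind_pmf (hist_pmf (s + j)) (\<lambda>t. map_pmf (\<lambda>u. add_mset (Upair u v) (collapsed t (s + j)))
      (attach_pmf \<delta> G0 m v (Suc j) (collapsed t (s + j))))"
    using Suc by (simp add: bind_map_pmf)
  also have "\<dots> = bind_pmf (hist_pmf (s + j)) (\<lambda>t. map_pmf (\<lambda>t. collapsed t (Suc (s + j)))
      (map_pmf (\<lambda>u. t(Suc (s + j) := u)) (step_pmf t (s + j))))"
  proof (rule bind_pmf_cong)
    fix t assume "t \<in> set_pmf (hist_pmf (s + j))"
    then have t: "t \<in> histories (s + j)" using set_hist_pmf[OF s] by auto
    show "map_pmf (\<lambda>u. add_mset (Upair u v) (collapsed t (s + j)))
        (attach_pmf \<delta> G0 m v (Suc j) (collapsed t (s + j))) =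
      map_pmf (\<lambda>t. collapsed t (Suc (s + j))) (map_pmf (\<lambda>u. t(Suc (s + j) := u)) (step_pmf t (s + j)))"
      using attach_pmf_collapsed[OF v, folded s_def, OF _ t] Suc.prems s
      by (simp add: pmf.map_comp o_def collapsed_upd grp)
  qed simp
  also have "\<dots> = map_pmf (\<lambda>t. collapsed t (s + Suc j)) (hist_pmf (s + Suc j))"
    unfolding add_Suc_right hist_pmf_Suc[OF s] map_bind_pmf ..
  finally show ?case .
qed

lemma PA_B_eq_collapsed:
  "n \<ge> 2 \<Longrightarrow> PA_B \<delta> G0 m n = map_pmf (\<lambda>t. collapsed t (psum m n)) (hist_pmf (psum m n))"
proof (induction n rule: nat_induct_at_least)
  case base
  then show ?case unfolding psum_2 hist_pmf_2 by (simp add: numeral_2_eq_2 collapsed_def)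
next
  case (Suc n)
  then show ?case
    using attach_edges_collapsed[of "Suc n" "m (Suc n)"] by (simp add: psum_Suc)
qed

text \<open>By \<open>\<beta>_Suc\<close> the second Beta parameter is the normalising constant of
  model (B) plus 1, the half-edge just given to the neighbour.\<close>

lemma psi_marginal_eq: 
  assumes "s \<ge> 1" shows "psi_marginal \<delta> G0 m s = psi_law s"
proof -
  consider "s = 1" | "s = 2" | "s \<ge> 3" using assms by linarith
  then show ?thesis
  proof cases
    case 2
    have "{1..<2} = {1::nat}" by auto
    then show ?thesis using 2 weight_1 weight_2 by (simp add: psi_marginal_def psi_law_def \<beta>_def)
  next
    case 3
    obtain k where k: "k \<ge> 1" "psum m (k - 1) < s" "s \<le> psum m k" "grp s = k"
      using group_of_obtain[OF assms] .
    have k3: "k \<ge> 3" using group_of_ge_3[OF 3] k by simp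
    have pk: "psum m k = psum m (k - 1) + m k" using psum_Suc[of m "k - 1"] k by simp
    \<comment> \<open>\<open>j\<close> counts the members of the group before \<open>s\<close>, so
      \<open>s\<close> stands for edge \<open>Suc j\<close> of \<open>k\<close>.\<close>
    define j where "j = s - psum m (k - 1) - 1"
    have s: "s = Suc (psum m (k - 1) + j)" "s - psum m (k - 1) = Suc j" and j: "j \<le> m k"
      using k pk by (auto simp: j_def)
    have "\<beta> s = attach_norm \<delta> G0 m k (Suc j) + 1"
      unfolding s(1) using total_eq_attach_norm[OF k3 j] by (subst \<beta>_Suc[OF psum_pred_ge_2[OF k3]]) simp
    moreover have "weight s = 1 + \<delta> / m k" using 3 k by (simp add: weight_def)
    moreover have "psi_marginal \<delta> G0 m s =
        beta_measure (1 + \<delta> / m k) (attach_norm \<delta> G0 m k (Suc j) + 1)"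
      unfolding psi_marginal_def Let_def k(4) s(2) using 3 by (simp add: attach_norm_def algebra_simps)
    ultimately show ?thesis
      using 3 by (simp add: psi_law_def)
  qed (simp add: psi_marginal_def psi_law_def)
qed

lemma urn_space_eq: "urn_space \<delta> G0 m = law"
  unfolding urn_space_def law_def
  by (intro arg_cong2[of _ _ _ _ pair_measure] PiM_cong) (auto simp: psi_marginal_eq)

text \<open>Vertices 1 and 2 form singleton groups with their own labels, so collapsing fixes
  \<open>G0\<close>.\<close>

lemma CPU_NSL_eq:
  "CPU_NSL G0 m n \<psi> U = collapsed (restrict (urn_target (psum m n) \<psi> U) {3..psum m n}) (psum m n)"
proof -
  have "image_mset (map_uprod grp) G0 = image_mset (\<lambda>e. e) G0"
  proof (rule image_mset_cong)
    fix e assume "e \<in># G0"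
    then have e: "set_uprod e \<subseteq> {1, 2}" using G0 by (auto simp: mgraph_on_def)
    obtain a b where ab: "e = Upair a b" by (cases e)
    then have "grp a = a" "grp b = b" using e group_of_1 group_of_2 by auto
    then show "map_uprod grp e = e" using ab by simp
  qed
  then show ?thesis
    unfolding CPU_NSL_def PU_NSL_def collapsed_def
    by (auto simp: image_mset.compositionality o_def intro!: image_mset_cong)
qed

text \<open>Both graphs are images of a history under \<open>collapsed\<close>, and by
  \<open>prob_target_event\<close> the two histories have the same law.\<close>

theorem pmf_PA_B_eq_CPU:
  assumes "n \<ge> 2"
  shows "pmf (PA_B \<delta> G0 m n) G =
    measure (urn_space \<delta> G0 m) {x \<in> space (urn_space \<delta> G0 m). CPU_NSL G0 m n (fst x) (snd x) = G}"
  unfolding urn_space_eq CPU_NSL_eq PA_B_eq_collapsed[OF assms] pmf_map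
  by (subst prob_target_event[OF psum_ge_2[OF assms]]) (simp add: vimage_def)

end

section \<open>Passing to random edge counts\<close>

theorem mainTheorem3:
  fixes M :: "nat pmf" and p \<delta> :: real
    and \<Omega> :: "'w measure" and m :: "nat \<Rightarrow> 'w \<Rightarrow> nat"
    and G0 :: mgraph and n :: nat
  assumes "0 \<notin> set_pmf M"
    and "p > 1" and "integrable (measure_pmf M) (\<lambda>k. real k powr p)"
    and "\<delta> > - real (Inf (set_pmf M))"
    and "prob_space \<Omega>"
    and "prob_space.indep_vars \<Omega> (\<lambda>_. count_space UNIV) m {3..}"
    and "\<And>i. i \<ge> 3 \<Longrightarrow> distr \<Omega> (count_space UNIV) (m i) = measure_pmf M"
    and "\<And>\<omega>. \<omega> \<in> space \<Omega> \<Longrightarrow> m 1 \<omega> = 1" and "\<And>\<omega>. \<omega> \<in> space \<Omega> \<Longrightarrow> m 2 \<omega> = 1"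
    and "mgraph_on {1, 2} G0"
    and "real (mdegree G0 1) + \<delta> > 0" and "real (mdegree G0 2) + \<delta> > 0"
    and "n \<ge> 2"
  shows "AE \<omega> in \<Omega>. \<forall>G. mgraph_on {1..n} G \<longrightarrow>
    pmf (PA_B \<delta> G0 (\<lambda>i. m i \<omega>) n) G =
    measure (urn_space \<delta> G0 (\<lambda>i. m i \<omega>))
      {x \<in> space (urn_space \<delta> G0 (\<lambda>i. m i \<omega>)).
        CPU_NSL G0 (\<lambda>i. m i \<omega>) n (fst x) (snd x) = G}"
proof -
  interpret prob_space \<Omega> by fact
  have "AE \<omega> in \<Omega>. m i \<omega> \<in> set_pmf M" if "i \<ge> 3" for i
  proof -
    have [measurable]: "m i \<in> measurable \<Omega> (count_space UNIV)"
      using assms(6) that by (auto simp: indep_vars_def)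
    have "AE k in distr \<Omega> (count_space UNIV) (m i). k \<in> set_pmf M"
      unfolding assms(7)[OF that] by (simp add: AE_measure_pmf)
    then show ?thesis by (subst (asm) AE_distr_iff) auto
  qed
  then have "AE \<omega> in \<Omega>. \<forall>i\<in>{3..}. m i \<omega> \<in> set_pmf M"
    by (intro AE_ball_countable') auto
  then show ?thesis
  proof (rule AE_mp, intro AE_I2 impI allI)
    fix \<omega> G assume \<omega>: "\<omega> \<in> space \<Omega>" and supp: "\<forall>i\<in>{3..}. m i \<omega> \<in> set_pmf M"
    \<comment> \<open>\<open>Inf\<close> is a lower bound of the support, so
      \<open>\<delta> > - real k\<close> there; division by \<open>k\<close> gives
      \<open>weight_pos\<close>.\<close>
    have pos: "k \<ge> 1 \<and> - real k < \<delta>" if "k \<in> set_pmf M" for k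
      using that assms(1,4) cInf_lower[of k "set_pmf M"] by (cases k) force+
    interpret collapse \<delta> G0 "\<lambda>i. m i \<omega>"
    proof
      show "m i \<omega> \<ge> 1" if "i \<ge> 1" for i
      proof -
        from that have "i = 1 \<or> i = 2 \<or> i \<ge> 3" by linarith
        then show ?thesis using assms(8,9)[OF \<omega>] pos supp by auto
      qed
      show "1 + \<delta> / real (m i \<omega>) > 0" if "i \<ge> 3" for i
        using pos[of "m i \<omega>"] supp that by (auto simp: field_simps)
    qed (use assms \<omega> in auto)
    show "pmf (PA_B \<delta> G0 (\<lambda>i. m i \<omega>) n) G =
      measure (urn_space \<delta> G0 (\<lambda>i. m i \<omega>))
        {x \<in> space (urn_space \<delta> G0 (\<lambda>i. m i \<omega>)). CPU_NSL G0 (\<lambda>i. m i \<omega>) n (fst x) (snd x) = G}"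
      by (rule pmf_PA_B_eq_CPU) fact
  qed
qed

end
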